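(* Let $n\ge 2$ and let $\alpha=\{\alpha_{ij}\}$ be nonnegative edge weights on the vertex set $\{1,\ldots,n\}$, with $\sum_{i=1}^{n-1}\alpha_{in}>0$. Let $\alpha'$ be the edge weights given by $$\alpha_{ij}'= \alpha_{ij} + \frac{\alpha_{in}\alpha_{jn}}{\alpha_{1n} + \cdots + \alpha_{n-1,n}}\quad (1\le i,j\le n-1,\ i\ne j),\qquad \alpha'_{in}=0\quad (i<n).$$ Then $$\mathcal L_n^{RW}(\alpha) = \mathcal L_n^{RW}(\alpha') + \frac1{\sum_{i=1}^{n-1}\alpha_{in}}\left(\sum_{i=1}^{n-1} \alpha_{in} w_{in}\right) \left(\sum_{i=1}^{n-1} \alpha_{in} w_{in}\right)^{\top}.$$ In particular, the eigenvalues of $\mathcal L_n^{RW}(\alpha)$ and $\mathcal L_n^{RW}(\alpha')$ interlace, i.e., $$\mu_1^n(\alpha')\le \mu_1^n(\alpha)\le \mu_2^n(\alpha')\le \cdots \le \mu_n^n(\alpha')\le \mu_n^n(\alpha).$$ Moreover, for $1\le k\le n$, $$\mu_k^n(\alpha)-\mu_k^n(\alpha')\le \frac{2\sum_{1\le i\le j \le n-1} \alpha_{in}\alpha_{jn}}{\sum_{i=1}^{n-1} \alpha_{in}}.$$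
   Context: Edge weights are symmetric: $\alpha_{ij}=\alpha_{ji}\ge 0$ for $i\ne j$ in $\{1,\ldots,n\}$. Let $e_1,\ldots,e_n$ be the standard basis (column vectors) of $\mathbb R^n$ and $w_{ij}=e_i-e_j$. The random-walk Laplacian is the $n\times n$ real symmetric matrix $\mathcal L_n^{RW}(\alpha)=\sum_{1\le i<j\le n}\alpha_{ij}w_{ij}w_{ij}^{\top}$; equivalently, its $(i,j)$ entry is $-\alpha_{ij}$ for $i\ne j$ and its $(j,j)$ entry is $\sum_{k\ne j}\alpha_{kj}$. The eigenvalues of $\mathcal L_n^{RW}(\alpha)$, with multiplicity, are written $\mu_1^n(\alpha)\le\cdots\le\mu_n^n(\alpha)$. *)

theory Defs
  imports
    "Jordan_Normal_Form.Char_Poly"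
    "HOL-Computational_Algebra.Fundamental_Theorem_Algebra"
begin

text \<open>The vertices are \<open>1, \<dots>, n\<close>. Diagonal values \<open>\<alpha> i i\<close> are unconstrained and never used.\<close>

definition edge_weights :: "nat \<Rightarrow> (nat \<Rightarrow> nat \<Rightarrow> real) \<Rightarrow> bool" where
  "edge_weights n \<alpha> \<longleftrightarrow>
     (\<forall>i\<in>{1..n}. \<forall>j\<in>{1..n}. i \<noteq> j \<longrightarrow> \<alpha> i j = \<alpha> j i \<and> 0 \<le> \<alpha> i j)"

text \<open>Coordinates of \<open>vec\<close> and \<open>mat\<close> are counted from 0, so the basis vector \<open>e\<^sub>i\<close> of
  vertex \<open>i\<close> is \<open>unit_vec n (i - 1)\<close>.\<close>

definition edge_vec :: "nat \<Rightarrow> nat \<Rightarrow> nat \<Rightarrow> real vec" where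
  "edge_vec n i j = unit_vec n (i - 1) - unit_vec n (j - 1)"

text \<open>The matrix \<open>v v\<^sup>T\<close> of a column vector \<open>v\<close>.\<close>

definition outer_square :: "real vec \<Rightarrow> real mat" where
  "outer_square v =
     mat_of_cols (dim_vec v) [v] * transpose_mat (mat_of_cols (dim_vec v) [v])"

definition RW_laplacian :: "nat \<Rightarrow> (nat \<Rightarrow> nat \<Rightarrow> real) \<Rightarrow> real mat" where
  "RW_laplacian n \<alpha> =
     finsum (module_mat TYPE(real) n n)
       (\<lambda>(i, j). \<alpha> i j \<cdot>\<^sub>m outer_square (edge_vec n i j))
       {(i, j). 1 \<le> i \<and> i < j \<and> j \<le> n}"

text \<open>The \<open>k\<close>-th smallest eigenvalue, \<open>k = 1, \<dots>, n\<close>, counted with multiplicity as a root of the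
  characteristic polynomial. Only real roots are listed; \<open>length_eigenvalues\<close> below shows that
  a real symmetric matrix has \<open>n\<close> of them.\<close>

definition eigenvalues :: "real mat \<Rightarrow> real list" where
  "eigenvalues A = sorted_list_of_multiset (proots (char_poly A))"

definition RW_eigenvalue :: "nat \<Rightarrow> nat \<Rightarrow> (nat \<Rightarrow> nat \<Rightarrow> real) \<Rightarrow> real" where
  "RW_eigenvalue k n \<alpha> = eigenvalues (RW_laplacian n \<alpha>) ! (k - 1)"

definition reduced_weights :: "nat \<Rightarrow> (nat \<Rightarrow> nat \<Rightarrow> real) \<Rightarrow> nat \<Rightarrow> nat \<Rightarrow> real" where
  "reduced_weights n \<alpha> i j =
     (if i = n \<or> j = n then 0
      else \<alpha> i j + \<alpha> i n * \<alpha> j n / (\<Sum>k = 1..n - 1. \<alpha> k n))"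

lemma edge_weights_reduced_weights:
  assumes "edge_weights n \<alpha>"
  shows "edge_weights n (reduced_weights n \<alpha>)"
proof -
  have "0 \<le> \<alpha> i n" if "i \<in> {1..n - 1}" for i
  proof -
    from that have "i \<in> {1..n}" "n \<in> {1..n}" "i \<noteq> n" by auto
    then show ?thesis using assms unfolding edge_weights_def by blast
  qed
  then have nn: "0 \<le> \<alpha> i n" if "i \<in> {1..n}" "i \<noteq> n" for i
    using that by auto
  then have "0 \<le> (\<Sum>k = 1..n - 1. \<alpha> k n)" by (intro sum_nonneg) auto
  with nn assms show ?thesis
    by (auto simp: edge_weights_def reduced_weights_def mult.commute)
qed

lemma index_outer_square:
  "r < dim_vec v \<Longrightarrow> c < dim_vec v \<Longrightarrow> outer_square v $$ (r, c) = v $ r * v $ c"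
  by (simp add: outer_square_def scalar_prod_def mat_of_cols_def)

lemma index_finsum_mat:
  fixes F :: "'a \<Rightarrow> real mat"
  assumes "finite S" "\<And>s. s \<in> S \<Longrightarrow> F s \<in> carrier_mat n m"
  shows "finsum (module_mat TYPE(real) n m) F S \<in> carrier_mat n m \<and>
    (\<forall>r<n. \<forall>c<m. finsum (module_mat TYPE(real) n m) F S $$ (r, c) = (\<Sum>s\<in>S. F s $$ (r, c)))"
  using assms
proof (induction S rule: finite_induct)
  case empty
  interpret abelian_group "module_mat TYPE(real) n m" by (rule abelian_group_mat)
  show ?case by (simp add: module_mat_simps)
next
  case (insert x S)
  interpret abelian_group "module_mat TYPE(real) n m" by (rule abelian_group_mat)
  have "finsum (module_mat TYPE(real) n m) F (insert x S) =
      F x + finsum (module_mat TYPE(real) n m) F S"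
    using insert by (subst finsum_insert) (auto simp: module_mat_simps)
  then show ?case using insert by auto
qed

lemma RW_laplacian_carrier: "RW_laplacian n \<alpha> \<in> carrier_mat n n"
  and index_RW_laplacian_sum: "r < n \<Longrightarrow> c < n \<Longrightarrow> RW_laplacian n \<alpha> $$ (r, c) =
    (\<Sum>(i, j)\<in>{(i, j). 1 \<le> i \<and> i < j \<and> j \<le> n}.
       \<alpha> i j * (edge_vec n i j $ r * edge_vec n i j $ c))"
proof -
  let ?S = "{(i, j). 1 \<le> i \<and> i < j \<and> j \<le> n}"
  let ?F = "\<lambda>(i, j). \<alpha> i j \<cdot>\<^sub>m outer_square (edge_vec n i j)"
  have fin: "finite ?S" by (rule finite_subset[of _ "{1..n} \<times> {1..n}"]) auto
  have dim: "dim_vec (edge_vec n i j) = n" for i j by (simp add: edge_vec_def)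
  have car: "outer_square (edge_vec n i j) \<in> carrier_mat n n" for i j
    unfolding outer_square_def dim by (intro mult_carrier_mat[of _ n 1]) auto
  have "?F s \<in> carrier_mat n n" for s using car by (cases s) auto
  note * = index_finsum_mat[of ?S ?F n n, OF fin this]
  show "RW_laplacian n \<alpha> \<in> carrier_mat n n" using * by (simp add: RW_laplacian_def)
  show "RW_laplacian n \<alpha> $$ (r, c) =
    (\<Sum>(i, j)\<in>?S. \<alpha> i j * (edge_vec n i j $ r * edge_vec n i j $ c))" if "r < n" "c < n"
  proof -
    have "RW_laplacian n \<alpha> $$ (r, c) = (\<Sum>s\<in>?S. ?F s $$ (r, c))"
      using * that by (simp add: RW_laplacian_def)
    also have "\<dots> = (\<Sum>(i, j)\<in>?S. \<alpha> i j * (edge_vec n i j $ r * edge_vec n i j $ c))"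
      using that car dim
      by (intro sum.cong refl) (auto simp: index_outer_square carrier_matD[OF car])
    finally show ?thesis .
  qed
qed

lemma RW_laplacian_symmetric: "transpose_mat (RW_laplacian n \<alpha>) = RW_laplacian n \<alpha>"
  using RW_laplacian_carrier[of n \<alpha>]
  by (intro eq_matI) (auto simp: index_RW_laplacian_sum mult.commute)

lemma symmetric_real_eigenvalue:
  fixes A :: "real mat"
  assumes A: "A \<in> carrier_mat n n" "transpose_mat A = A"
    and root: "poly (char_poly (map_mat complex_of_real A)) z = 0"
  shows "z \<in> \<real>"
proof -
  let ?A = "map_mat complex_of_real A"
  have cA: "?A \<in> carrier_mat n n" using A by simp
  have "eigenvalue ?A z" using eigenvalue_root_char_poly[OF cA] root by simp
  then obtain v where v: "v \<in> carrier_vec n" "v \<noteq> 0\<^sub>v n" "?A *\<^sub>v v = z \<cdot>\<^sub>v v"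
    using cA unfolding eigenvalue_def eigenvector_def by auto
  have sym: "A $$ (i, j) = A $$ (j, i)" if "i < n" "j < n" for i j
    using A that by (metis index_transpose_mat(1) carrier_matD)
  have row: "(\<Sum>j<n. of_real (A $$ (i, j)) * v $ j) = z * v $ i" if "i < n" for i
    using arg_cong[OF v(3), of "\<lambda>w. w $ i"] that v(1) A
    by (simp add: scalar_prod_def atLeast0LessThan)
  have row': "(\<Sum>j<n. of_real (A $$ (i, j)) * cnj (v $ j)) = cnj z * cnj (v $ i)" if "i < n" for i
    using arg_cong[OF row[OF that], of cnj] by simp
  let ?N = "\<Sum>i<n. v $ i * cnj (v $ i)"
  have "z * ?N = (\<Sum>i<n. (\<Sum>j<n. of_real (A $$ (i, j)) * v $ j) * cnj (v $ i))"
    by (simp add: row sum_distrib_left mult.assoc)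
  also have "\<dots> = (\<Sum>i<n. \<Sum>j<n. of_real (A $$ (i, j)) * v $ j * cnj (v $ i))"
    by (simp add: sum_distrib_right)
  also have "\<dots> = (\<Sum>j<n. \<Sum>i<n. of_real (A $$ (i, j)) * v $ j * cnj (v $ i))"
    by (rule sum.swap)
  also have "\<dots> = (\<Sum>j<n. v $ j * (\<Sum>i<n. of_real (A $$ (j, i)) * cnj (v $ i)))"
    unfolding sum_distrib_left by (intro sum.cong refl) (auto simp: sym)
  also have "\<dots> = (\<Sum>j<n. v $ j * (cnj z * cnj (v $ j)))"
    by (intro sum.cong refl) (simp add: row')
  also have "\<dots> = cnj z * ?N" by (simp add: sum_distrib_left ac_simps)
  finally have eq: "z * ?N = cnj z * ?N" .
  have N: "?N = of_real (\<Sum>i<n. (cmod (v $ i))\<^sup>2)"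
    by (simp add: complex_norm_square[symmetric])
  obtain i where i: "i < n" "v $ i \<noteq> 0" using v(1,2) by (metis eq_vecI carrier_vecD index_zero_vec)
  have "(cmod (v $ i))\<^sup>2 \<le> (\<Sum>i<n. (cmod (v $ i))\<^sup>2)"
    using i by (intro member_le_sum) auto
  with i have "(\<Sum>i<n. (cmod (v $ i))\<^sup>2) \<noteq> 0"
    by (metis norm_eq_zero power2_less_eq_zero_iff)
  then have "?N \<noteq> 0" unfolding N of_real_eq_0_iff .
  with eq have "z = cnj z" by simp
  then show ?thesis by (metis Reals_cnj_iff)
qed

lemma length_eigenvalues:
  assumes A: "A \<in> carrier_mat n n" "transpose_mat A = A"
  shows "length (eigenvalues A) = n"
proof -
  let ?A = "map_mat complex_of_real A" and ?c = "map_poly complex_of_real"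
  have cA: "?A \<in> carrier_mat n n" using A by simp
  have P: "char_poly ?A = ?c (char_poly A)"
    by (rule of_real_hom.char_poly_hom[OF A(1)])
  from fundamental_theorem_algebra_factorized[of "char_poly ?A"]
  obtain rs where rs: "char_poly ?A = (\<Prod>x\<leftarrow>rs. [:-x, 1:])"
    using degree_monic_char_poly[OF cA] by (metis smult_1_left)
  have real: "of_real (Re x) = x" if "x \<in> set rs" for x
  proof -
    have "poly (char_poly ?A) x = 0" unfolding rs using that by (auto simp: poly_prod_list prod_list_zero_iff)
    from symmetric_real_eigenvalue[OF A this] show ?thesis by simp
  qed
  interpret c: map_poly_inj_idom_hom complex_of_real ..
  have "?c (\<Prod>x\<leftarrow>rs. [:- Re x, 1:]) = (\<Prod>x\<leftarrow>rs. [:-x, 1:])"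
    using real by (induction rs) (auto simp: c.hom_mult simp del: mult_pCons_left)
  then have "?c (\<Prod>x\<leftarrow>rs. [:- Re x, 1:]) = ?c (char_poly A)" using rs P by simp
  then have *: "char_poly A = (\<Prod>x\<leftarrow>rs. [:- Re x, 1:])" by simp
  have pr: "proots (\<Prod>x\<leftarrow>rs. [:- Re x, 1:]) = mset (map Re rs)"
  proof (induction rs)
    case (Cons a rs)
    have "(\<Prod>x\<leftarrow>rs. [:- Re x, 1:]) \<noteq> 0" by (auto simp: prod_list_zero_iff)
    then show ?case using Cons.IH by (simp add: proots_mult del: mult_pCons_left)
  qed simp
  have dg: "degree (\<Prod>x\<leftarrow>rs. [:- Re x, 1:]) = length rs"
    by (rule degree_linear_factors)
  have "length (eigenvalues A) = size (proots (char_poly A))"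
    unfolding eigenvalues_def by (metis mset_sorted_list_of_multiset size_mset)
  also have "\<dots> = degree (char_poly A)" unfolding * pr using dg by simp
  also have "\<dots> = n" using degree_monic_char_poly[OF A(1)] by simp
  finally show ?thesis .
qed

lemma length_eigenvalues_RW_laplacian: "length (eigenvalues (RW_laplacian n \<alpha>)) = n"
  by (rule length_eigenvalues[OF RW_laplacian_carrier RW_laplacian_symmetric])

end

theory Submission
  imports Defs
begin

text \<open>Put \<open>a\<^sub>i = \<alpha> i n\<close>, \<open>S = \<Sum> a\<^sub>i\<close> and \<open>v = \<Sum> a\<^sub>i w\<^sub>i\<^sub>n\<close>. Entry by entry, the matrix identity is the Lagrange
  identity \<open>S \<Sum> a\<^sub>i p\<^sub>i q\<^sub>i = \<Sum>\<^sub>i\<^sub><\<^sub>j a\<^sub>i a\<^sub>j (p\<^sub>i - p\<^sub>j) (q\<^sub>i - q\<^sub>j) + (\<Sum> a\<^sub>i p\<^sub>i) (\<Sum> a\<^sub>i q\<^sub>i)\<close>, where \<open>p\<^sub>i\<close>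
  and \<open>q\<^sub>i\<close> are coordinates of \<open>w\<^sub>i\<^sub>n\<close>. Hence the quadratic forms of the two Laplacians
  differ by \<open>(v \<bullet> x)\<^sup>2 / S\<close>, which is nonnegative, vanishes on the hyperplane orthogonal to \<open>v\<close>, and is at
  most \<open>(v \<bullet> v) / S\<close> times \<open>x \<bullet> x\<close>, where \<open>v \<bullet> v = S\<^sup>2 + \<Sum> a\<^sub>i\<^sup>2\<close>. Each property gives one of the three
  eigenvalue inequalities by a Courant--Fischer comparison: for orthonormal eigenbases \<open>u\<close> of \<open>A\<close>
  and \<open>z\<close> of \<open>B\<close> and \<open>r\<close> linear constraints, the vectors orthogonal to \<open>u\<^sub>i\<close> (\<open>i < k\<close>), to \<open>z\<^sub>i\<close>
  (\<open>i > k + r\<close>) and satisfying the constraints solve \<open>n - 1\<close> linear equations, so there is a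
  nonzero one, and its two Rayleigh quotients separate the \<open>k\<close>-th eigenvalue of \<open>A\<close> from the
  \<open>(k + r)\<close>-th of \<open>B\<close>.\<close>

section \<open>Orthogonal diagonalization of real symmetric matrices\<close>

lemma scalar_prod_self_pos:
  fixes v :: "real vec"
  assumes "v \<in> carrier_vec n" "v \<noteq> 0\<^sub>v n"
  shows "0 < v \<bullet> v"
proof -
  have "conjugate v = v" by (rule eq_vecI) auto
  then show ?thesis using conjugate_square_greater_0_vec[OF assms(1)] assms(2) by simp
qed

text \<open>The reflection \<open>I - c u u^T\<close> along \<open>u = v - unit_vec n 0\<close>
  exchanges two vectors of equal length. It completes a unit vector to an orthogonal matrix, and
  being a symmetric involution it is its own inverse and transpose.\<close>

lemma householder_reflection:
  fixes v :: "real vec"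
  assumes v: "v \<in> carrier_vec n" "v \<bullet> v = 1" and n: "0 < n"
  obtains W where "W \<in> carrier_mat n n" "transpose_mat W = W" "W * W = 1\<^sub>m n"
    "W *\<^sub>v unit_vec n 0 = v"
proof -
  define u where "u = v - unit_vec n 0"
  \<comment> \<open>For \<open>v = unit_vec n 0\<close> this is \<open>2 / 0 = 0\<close>, and \<open>W\<close> is the identity.\<close>
  define c where "c = 2 / (u \<bullet> u)"
  define W where "W = mat n n (\<lambda>(i, j). (if i = j then 1 else 0) - c * (u $ i * u $ j))"
  have u: "u \<in> carrier_vec n" using v by (simp add: u_def)
  have uu: "(\<Sum>k<n. u $ k * u $ k) = u \<bullet> u"
    using u by (simp add: scalar_prod_def atLeast0LessThan)
  \<comment> \<open>Holds for \<open>u \<bullet> u = 0\<close> too, since then \<open>c = 0\<close>.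
    In \<open>W * W\<close> it cancels the quadratic term against the two linear ones.\<close>
  have cc: "c * c * (u \<bullet> u) = 2 * c" by (simp add: c_def)
  show thesis
  proof
    show W: "W \<in> carrier_mat n n" by (simp add: W_def)
    show "transpose_mat W = W" by (rule eq_matI) (auto simp: W_def)
    show "W * W = 1\<^sub>m n"
    proof (rule eq_matI)
      fix i j assume "i < dim_row (1\<^sub>m n :: real mat)" "j < dim_col (1\<^sub>m n :: real mat)"
      then have ij: "i < n" "j < n" by auto
      have "(W * W) $$ (i, j) = (\<Sum>k<n. ((if i = k then 1 else 0) - c * (u $ i * u $ k)) *
          ((if k = j then 1 else 0) - c * (u $ k * u $ j)))"
        using ij by (simp add: W_def scalar_prod_def atLeast0LessThan)
      also have "\<dots> = (\<Sum>k<n. (if k = i then if i = j then 1 else 0 else 0)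
          - (if k = i then c * (u $ i * u $ j) else 0) - (if k = j then c * (u $ i * u $ j) else 0)
          + c * c * u $ i * u $ j * (u $ k * u $ k))"
        by (intro sum.cong refl) (auto simp: algebra_simps)
      also have "\<dots> = (if i = j then 1 else 0) - 2 * c * (u $ i * u $ j)
          + c * c * (u \<bullet> u) * (u $ i * u $ j)"
        using ij by (simp add: sum.distrib sum_subtractf sum.delta sum_distrib_left[symmetric] uu)
      also have "\<dots> = 1\<^sub>m n $$ (i, j)" using ij by (simp add: cc)
      finally show "(W * W) $$ (i, j) = 1\<^sub>m n $$ (i, j)" .
    qed (use W in auto)
    have u0: "u $ 0 = v $ 0 - 1" using n by (simp add: u_def)
    \<comment> \<open>Both \<open>v\<close> and \<open>unit_vec n 0\<close> have length 1, so the
      squared distance is \<open>2 - 2 * v $ 0\<close>.\<close>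
    have uu2: "u \<bullet> u = - 2 * u $ 0"
    proof -
      have "u \<bullet> u = v \<bullet> v - v $ 0 - (v $ 0 - 1)"
        unfolding u_def using v n
        by (simp add: minus_scalar_prod_distrib[of _ n] scalar_prod_minus_distrib[of _ n])
      then show ?thesis using v u0 by simp
    qed
    \<comment> \<open>Column 0 of \<open>W\<close> is \<open>unit_vec n 0 - c * u $ 0 * u\<close>;
      with this it becomes \<open>unit_vec n 0 + u = v\<close>.\<close>
    have cu: "- c * u $ 0 * u $ i = u $ i" if "i < n" for i
    proof (cases "u \<bullet> u = 0")
      case True
      then have "u = 0\<^sub>v n" using scalar_prod_self_pos[OF u] by force
      then show ?thesis using that by simp
    next
      case False
      then show ?thesis using uu2 by (simp add: c_def field_simps)
    qed
    show "W *\<^sub>v unit_vec n 0 = v"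
    proof (rule eq_vecI)
      fix i assume "i < dim_vec v"
      then have i: "i < n" using v by simp
      have "(W *\<^sub>v unit_vec n 0) $ i = W $$ (i, 0)" using W i n by simp
      also have "\<dots> = unit_vec n 0 $ i + u $ i"
        using i n cu[OF i] by (simp add: W_def unit_vec_def mult.assoc mult.commute mult.left_commute)
      also have "\<dots> = v $ i" using i v by (simp add: u_def)
      finally show "(W *\<^sub>v unit_vec n 0) $ i = v $ i" .
    qed (use v W in auto)
  qed
qed

text \<open>Deflation, by induction on the list of roots: a reflection moves a unit eigenvector for
  \<open>e\<close> to the first coordinate, and symmetry then splits off a 1 by 1 block
  \<open>e\<close>, leaving a smaller symmetric matrix with the remaining roots. The diagonal keeps
  the order of \<open>es\<close>, so a sorted list gives a sorted diagonal.\<close>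

lemma orthogonal_diagonalization:
  fixes A :: "real mat"
  assumes "A \<in> carrier_mat n n" "transpose_mat A = A" "char_poly A = (\<Prod>e\<leftarrow>es. [:- e, 1:])"
  shows "\<exists>P. similar_mat_wit A (mat_diag n ((!) es)) P (transpose_mat P)"
  using assms
proof (induction es arbitrary: n A)
  case Nil
  then have "n = 0" using degree_monic_char_poly[of A n] by simp
  then have "similar_mat_wit A (mat_diag n ((!) [])) (1\<^sub>m 0) (transpose_mat (1\<^sub>m 0))"
    using Nil by (auto simp: similar_mat_wit_def Let_def mat_diag_def)
  then show ?case by blast
next
  case (Cons e es n A)
  note A = Cons.prems(1,2)
  have "poly (char_poly A) e = 0" unfolding Cons.prems by simp
  then have "eigenvalue A e" using eigenvalue_root_char_poly[OF A(1)] by simp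
  then obtain v' where v': "v' \<in> carrier_vec n" "v' \<noteq> 0\<^sub>v n" "A *\<^sub>v v' = e \<cdot>\<^sub>v v'"
    using A unfolding eigenvalue_def eigenvector_def by auto
  note vv = scalar_prod_self_pos[OF v'(1,2)]
  define v where "v = (1 / sqrt (v' \<bullet> v')) \<cdot>\<^sub>v v'"
  have v: "v \<in> carrier_vec n" "v \<bullet> v = 1" "A *\<^sub>v v = e \<cdot>\<^sub>v v"
    using v' vv A by (auto simp: v_def smult_smult_assoc mult.commute mult_mat_vec[of _ n n])
  obtain m where n: "n = Suc m" using v' by (cases n) auto
  obtain W where W: "W \<in> carrier_mat n n" "transpose_mat W = W" "W * W = 1\<^sub>m n"
    "W *\<^sub>v unit_vec n 0 = v"
    using householder_reflection[OF v(1,2)] n by auto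
  define C where "C = W * A * W"
  have C: "C \<in> carrier_mat n n" using W A by (simp add: C_def)
  have CT: "transpose_mat C = C"
    using W A by (simp add: C_def transpose_mult[of _ n n _ n] assoc_mult_mat[of _ n n _ n _ n])
  have Wv: "W *\<^sub>v v = unit_vec n 0"
    using W by (metis assoc_mult_mat_vec one_mult_mat_vec unit_vec_carrier)
  have "C *\<^sub>v unit_vec n 0 = W *\<^sub>v (A *\<^sub>v (W *\<^sub>v unit_vec n 0))"
    using W A by (simp add: C_def assoc_mult_mat_vec[of _ n n _ n])
  also have "\<dots> = e \<cdot>\<^sub>v unit_vec n 0" using W v Wv by (simp add: mult_mat_vec[of _ n n])
  finally have "C *\<^sub>v unit_vec n 0 = e \<cdot>\<^sub>v unit_vec n 0" .
  moreover have "C $$ (i, 0) = (C *\<^sub>v unit_vec n 0) $ i" if "i < n" for i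
    using that C n by simp
  ultimately have C0: "C $$ (i, 0) = (if i = 0 then e else 0)" if "i < n" for i
    using that n by (simp add: unit_vec_def)
  have C0': "C $$ (0, i) = (if i = 0 then e else 0)" if "i < n" for i
    using C0[OF that] CT C that n by (metis carrier_matD index_transpose_mat(1) zero_less_Suc)
  define D where "D = mat m m (\<lambda>(i, j). C $$ (Suc i, Suc j))"
  define E where "E = mat 1 1 (\<lambda>_. e)"
  have D: "D \<in> carrier_mat m m" "transpose_mat D = D"
    using CT C n by (auto simp: D_def intro!: eq_matI) (metis carrier_matD index_transpose_mat(1) Suc_less_eq)
  have E: "E \<in> carrier_mat 1 1" by (simp add: E_def)
  have block: "C = four_block_mat E (0\<^sub>m 1 m) (0\<^sub>m m 1) D"
    using C n by (intro eq_matI) (auto simp: E_def D_def C0 C0')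
  have sim: "similar_mat_wit A C W W"
    using W A C by (intro similar_mat_witI[of _ _ n])
      (auto simp: C_def assoc_mult_mat[of _ n n _ n _ n] simp flip: assoc_mult_mat[of W n n W n _ n])
  have "char_poly A = char_poly C" using sim by (intro char_poly_similar) (auto simp: similar_mat_def)
  also have "\<dots> = [:- e, 1:] * char_poly D"
    unfolding block char_poly_four_block_zeros_col[OF E zero_carrier_mat D(1)]
    by (simp add: E_def char_poly_defs det_def sign_def)
  finally have "[:- e, 1:] * char_poly D = [:- e, 1:] * (\<Prod>e\<leftarrow>es. [:- e, 1:])"
    unfolding Cons.prems(3) list.map prod_list.Cons by (rule sym)
  then have "char_poly D = (\<Prod>e\<leftarrow>es. [:- e, 1:])"
    by (subst (asm) mult_left_cancel) auto
  from Cons.IH[OF D this] obtain P where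
    P: "similar_mat_wit D (mat_diag m ((!) es)) P (transpose_mat P)" by auto
  note Pc = similar_mat_witD2[OF D(1) P]
  \<comment> \<open>\<open>R\<close> fixes the eigenvector already found and diagonalizes the block
    \<open>D\<close>; \<open>W * R\<close> then diagonalizes \<open>A\<close>.\<close>
  define R where "R = four_block_mat (1\<^sub>m 1) (0\<^sub>m 1 m) (0\<^sub>m m 1) P"
  have RT: "transpose_mat R = four_block_mat (1\<^sub>m 1) (0\<^sub>m 1 m) (0\<^sub>m m 1) (transpose_mat P)"
    unfolding R_def using Pc by (subst transpose_four_block_mat[of _ 1 1 _ m _ m]) auto
  have R: "R \<in> carrier_mat n n"
    unfolding R_def n using Pc four_block_carrier_mat[of "1\<^sub>m 1" 1 1 P m m] by simp
  have diag: "mat_diag n ((!) (e # es)) = four_block_mat E (0\<^sub>m 1 m) (0\<^sub>m m 1) (mat_diag m ((!) es))"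
    using n by (intro eq_matI) (auto simp: mat_diag_def E_def)
  have "similar_mat_wit C (mat_diag n ((!) (e # es))) R (transpose_mat R)"
    unfolding block diag RT unfolding R_def
    by (rule similar_mat_wit_four_block[OF similar_mat_wit_refl[OF E] P _ _ E D(1)])
      (use Pc in auto)
  from similar_mat_wit_trans[OF sim this]
  have "similar_mat_wit A (mat_diag n ((!) (e # es))) (W * R) (transpose_mat (W * R))"
    using W R by (simp add: transpose_mult[of _ n n _ n])
  then show ?case by blast
qed

text \<open>Splitting off one root lowers the degree and the number of roots by one each, so
  equality of the two persists down to degree 0. This turns the count in
  \<open>length_eigenvalues\<close> into the factorization that the diagonalization starts
  from.\<close>

lemma monic_eq_prod_proots:
  fixes p :: "'a :: idom poly"
  assumes "lead_coeff p = 1" "size (proots p) = degree p"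
  shows "p = (\<Prod>a\<in>#proots p. [:- a, 1:])"
  using assms
proof (induction "degree p" arbitrary: p)
  case 0
  then have "p = 1" using monic_degree_0[of p] by auto
  then show ?case by simp
next
  case (Suc d p)
  then have p0: "p \<noteq> 0" by auto
  obtain a where "a \<in># proots p" using Suc by (metis multiset_nonemptyE size_empty nat.distinct(1))
  then obtain q where pq: "p = [:- a, 1:] * q" using p0 by (auto simp: poly_eq_0_iff_dvd)
  then have q0: "q \<noteq> 0" using p0 by auto
  have pr: "proots p = add_mset a (proots q)"
    unfolding pq using q0 by (subst proots_mult) auto
  have dg: "degree p = Suc (degree q)"
    unfolding pq using q0 by (subst degree_mult_eq) auto
  have "lead_coeff q = 1" using Suc.prems(1) unfolding pq lead_coeff_mult by simp
  then have "q = (\<Prod>a\<in>#proots q. [:- a, 1:])"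
    using Suc.hyps(2) Suc.prems(2) pr dg by (intro Suc.hyps(1)) auto
  then show ?case using pq pr by simp
qed

lemma char_poly_eigenvalues:
  fixes A :: "real mat"
  assumes A: "A \<in> carrier_mat n n" "transpose_mat A = A"
  shows "char_poly A = (\<Prod>e\<leftarrow>eigenvalues A. [:- e, 1:])"
proof -
  let ?p = "char_poly A"
  have p: "degree ?p = n" "lead_coeff ?p = 1" using degree_monic_char_poly[OF A(1)] by auto
  have "size (proots ?p) = degree ?p"
    using length_eigenvalues[OF A] p(1) unfolding eigenvalues_def
    by (metis mset_sorted_list_of_multiset size_mset)
  then have "?p = (\<Prod>e\<in>#proots ?p. [:- e, 1:])"
    using p(2) by (intro monic_eq_prod_proots) auto
  also have "\<dots> = (\<Prod>e\<leftarrow>eigenvalues A. [:- e, 1:])"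
    unfolding eigenvalues_def
    by (metis mset_map mset_sorted_list_of_multiset prod_mset_prod_list)
  finally show ?thesis .
qed

text \<open>The \<open>u i\<close> are the columns of the diagonalizing matrix. They are exported
  through Parseval and the diagonal quadratic form, the two halves of a Rayleigh quotient.\<close>

lemma spectral_coordinates:
  fixes A :: "real mat"
  assumes A: "A \<in> carrier_mat n n" "transpose_mat A = A"
  obtains u where "\<And>i. i < n \<Longrightarrow> u i \<in> carrier_vec n"
    "\<And>x. x \<in> carrier_vec n \<Longrightarrow> x \<bullet> x = (\<Sum>i<n. (u i \<bullet> x)\<^sup>2)"
    "\<And>x. x \<in> carrier_vec n \<Longrightarrow> x \<bullet> (A *\<^sub>v x) = (\<Sum>i<n. eigenvalues A ! i * (u i \<bullet> x)\<^sup>2)"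
proof -
  let ?D = "mat_diag n ((!) (eigenvalues A))"
  obtain P where P: "similar_mat_wit A ?D P (transpose_mat P)"
    using orthogonal_diagonalization[OF A char_poly_eigenvalues[OF A]] by auto
  note PD = similar_mat_witD2[OF A(1) P]
  note P = PD(6)
  \<comment> \<open>General \<open>B\<close> serves twice: the identity matrix gives Parseval, the
    diagonal matrix gives the form of \<open>A\<close>.\<close>
  have quad: "x \<bullet> ((P * B * transpose_mat P) *\<^sub>v x)
      = (transpose_mat P *\<^sub>v x) \<bullet> (B *\<^sub>v (transpose_mat P *\<^sub>v x))"
    if x: "x \<in> carrier_vec n" and B: "B \<in> carrier_mat n n" for x B
  proof -
    have "(P * B * transpose_mat P) *\<^sub>v x = P *\<^sub>v (B *\<^sub>v (transpose_mat P *\<^sub>v x))"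
      using x B P by (simp add: assoc_mult_mat_vec[of _ n n _ n])
    then show ?thesis
      using x B P transpose_vec_mult_scalar[OF P, of "B *\<^sub>v (transpose_mat P *\<^sub>v x)" x]
      by (simp add: mult_mat_vec_carrier)
  qed
  show thesis
  proof
    show "col P i \<in> carrier_vec n" if "i < n" for i using P by auto
    fix x :: "real vec" assume x: "x \<in> carrier_vec n"
    let ?y = "transpose_mat P *\<^sub>v x"
    have y: "?y $ i = col P i \<bullet> x" if "i < n" for i using that P by simp
    have "x \<bullet> x = ?y \<bullet> ?y"
      using quad[OF x one_carrier_mat] PD x P by simp
    also have "\<dots> = (\<Sum>i<n. (col P i \<bullet> x)\<^sup>2)"
      using P y by (simp add: scalar_prod_def[of ?y ?y] atLeast0LessThan power2_eq_square)
    finally show "x \<bullet> x = (\<Sum>i<n. (col P i \<bullet> x)\<^sup>2)" .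
    have D: "?D *\<^sub>v ?y = vec n (\<lambda>i. eigenvalues A ! i * ?y $ i)"
    proof (rule eq_vecI)
      fix i assume "i < dim_vec (vec n (\<lambda>i. eigenvalues A ! i * ?y $ i))"
      then have i: "i < n" by simp
      have "(?D *\<^sub>v ?y) $ i = (\<Sum>j<n. (if i = j then eigenvalues A ! j else 0) * ?y $ j)"
        using i P by (simp add: mat_diag_def scalar_prod_def[of _ ?y] atLeast0LessThan del: index_mult_mat_vec(1))
          (simp add: index_mult_mat_vec(1)[of i] scalar_prod_def[of _ ?y] atLeast0LessThan)
      also have "\<dots> = (\<Sum>j<n. if j = i then eigenvalues A ! i * ?y $ i else 0)"
        by (intro sum.cong) auto
      finally show "(?D *\<^sub>v ?y) $ i = vec n (\<lambda>i. eigenvalues A ! i * ?y $ i) $ i"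
        using i by simp
    qed (simp add: mat_diag_def)
    have "x \<bullet> (A *\<^sub>v x) = ?y \<bullet> (?D *\<^sub>v ?y)"
      using quad[OF x mat_diag_dim[of n "(!) (eigenvalues A)"]] PD(3) by simp
    also have "\<dots> = (\<Sum>i<n. eigenvalues A ! i * (col P i \<bullet> x)\<^sup>2)"
      unfolding D using P y
      by (simp add: scalar_prod_def[of ?y] atLeast0LessThan power2_eq_square ac_simps)
    finally show "x \<bullet> (A *\<^sub>v x) = (\<Sum>i<n. eigenvalues A ! i * (col P i \<bullet> x)\<^sup>2)" .
  qed
qed

section \<open>Courant-Fischer comparison of ordered eigenvalues\<close>

lemma ex_nonzero_orthogonal:
  fixes ws :: "'a :: field vec list"
  assumes ws: "set ws \<subseteq> carrier_vec n" "length ws < n"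
  obtains x where "x \<in> carrier_vec n" "x \<noteq> 0\<^sub>v n" "\<And>w. w \<in> set ws \<Longrightarrow> w \<bullet> x = 0"
proof -
  let ?c = "\<lambda>i. if i < length ws then ws ! i else 0\<^sub>v n"
  \<comment> \<open>Zero rows pad the list to a square matrix. As \<open>length ws < n\<close>, row
    \<open>n - 1\<close> is one of them, so the matrix is singular, and a kernel vector is
    orthogonal to every listed vector.\<close>
  let ?M = "mat\<^sub>r n n (\<lambda>i. if i = n - 1 then 0\<^sub>v n else ?c i)"
  have M: "?M \<in> carrier_mat n n" by simp
  have c: "?c i \<in> carrier_vec n" for i using ws(1) by auto
  have "det ?M = 0" using ws(2) c by (intro det_row_0) auto
  then obtain x where x: "x \<in> carrier_vec n" "x \<noteq> 0\<^sub>v n" "?M *\<^sub>v x = 0\<^sub>v n"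
    using det_0_iff_vec_prod_zero_field[OF M] by auto
  have "w \<bullet> x = 0" if w: "w \<in> set ws" for w
  proof -
    obtain i where i: "i < length ws" "w = ws ! i" using w by (auto simp: in_set_conv_nth)
    have "row ?M i = w" using i ws(2) c[of i] by (subst row_mat_of_row_fun) auto
    then have "w \<bullet> x = (?M *\<^sub>v x) $ i" using i ws(2) M by (subst index_mult_mat_vec) auto
    then show ?thesis unfolding x(3) using i ws(2) by simp
  qed
  with x show thesis using that by blast
qed

lemma sorted_eigenvalues: "sorted (eigenvalues A)"
  by (simp add: eigenvalues_def)

text \<open>The constraints \<open>ws\<close> and the slack \<open>c\<close> let one argument cover
  three cases: no constraint and \<open>c = 0\<close> for monotonicity, one constraint and
  \<open>c = 0\<close> for interlacing, no constraint and positive \<open>c\<close> for the gap.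
  Each constraint costs one index.\<close>

lemma eigenvalue_comparison:
  fixes A B :: "real mat" and ws :: "real vec list"
  assumes A: "A \<in> carrier_mat n n" "transpose_mat A = A"
    and B: "B \<in> carrier_mat n n" "transpose_mat B = B"
    and ws: "set ws \<subseteq> carrier_vec n"
    and le: "\<And>x. x \<in> carrier_vec n \<Longrightarrow> (\<And>w. w \<in> set ws \<Longrightarrow> w \<bullet> x = 0) \<Longrightarrow>
      x \<bullet> (A *\<^sub>v x) \<le> x \<bullet> (B *\<^sub>v x) + c * (x \<bullet> x)"
    and k: "k + length ws < n"
  shows "eigenvalues A ! k \<le> eigenvalues B ! (k + length ws) + c"
proof -
  obtain u where u: "\<And>i. i < n \<Longrightarrow> u i \<in> carrier_vec n"
    "\<And>x. x \<in> carrier_vec n \<Longrightarrow> x \<bullet> x = (\<Sum>i<n. (u i \<bullet> x)\<^sup>2)"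
    "\<And>x. x \<in> carrier_vec n \<Longrightarrow> x \<bullet> (A *\<^sub>v x) = (\<Sum>i<n. eigenvalues A ! i * (u i \<bullet> x)\<^sup>2)"
    using spectral_coordinates[OF A] by blast
  obtain v where v: "\<And>i. i < n \<Longrightarrow> v i \<in> carrier_vec n"
    "\<And>x. x \<in> carrier_vec n \<Longrightarrow> x \<bullet> x = (\<Sum>i<n. (v i \<bullet> x)\<^sup>2)"
    "\<And>x. x \<in> carrier_vec n \<Longrightarrow> x \<bullet> (B *\<^sub>v x) = (\<Sum>i<n. eigenvalues B ! i * (v i \<bullet> x)\<^sup>2)"
    using spectral_coordinates[OF B] by blast
  let ?r = "length ws"
  \<comment> \<open>The lengths \<open>k\<close>, \<open>n - 1 - (k + ?r)\<close> and
    \<open>?r\<close> add up to \<open>n - 1\<close>.\<close>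
  let ?vs = "map u [0..<k] @ map v [Suc (k + ?r)..<n] @ ws"
  have "set ?vs \<subseteq> carrier_vec n" "length ?vs < n" using u(1) v(1) ws k by auto
  then obtain x where x: "x \<in> carrier_vec n" "x \<noteq> 0\<^sub>v n" "\<And>w. w \<in> set ?vs \<Longrightarrow> w \<bullet> x = 0"
    using ex_nonzero_orthogonal by blast
  have ux: "u i \<bullet> x = 0" if "i < k" for i using that by (intro x(3)) auto
  have vx: "v i \<bullet> x = 0" if "k + ?r < i" "i < n" for i using that by (intro x(3)) auto
  have len: "length (eigenvalues A) = n" "length (eigenvalues B) = n"
    using length_eigenvalues A B by auto
  have "eigenvalues A ! k * (x \<bullet> x) = (\<Sum>i<n. eigenvalues A ! k * (u i \<bullet> x)\<^sup>2)"
    by (simp add: u(2)[OF x(1)] sum_distrib_left)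
  \<comment> \<open>Terms with \<open>i < k\<close> vanish by the choice of \<open>x\<close>; the
    others grow by sortedness. The bound for \<open>B\<close> below is the mirror image, with the
    terms above \<open>k + ?r\<close> vanishing.\<close>
  also have "\<dots> \<le> (\<Sum>i<n. eigenvalues A ! i * (u i \<bullet> x)\<^sup>2)"
  proof (rule sum_mono)
    fix i assume "i \<in> {..<n}"
    then show "eigenvalues A ! k * (u i \<bullet> x)\<^sup>2 \<le> eigenvalues A ! i * (u i \<bullet> x)\<^sup>2"
      using ux[of i] sorted_nth_mono[OF sorted_eigenvalues, of k i A] len
      by (cases "i < k") (auto intro: mult_right_mono)
  qed
  also have "\<dots> \<le> (\<Sum>i<n. eigenvalues B ! i * (v i \<bullet> x)\<^sup>2) + c * (x \<bullet> x)"
    using le[OF x(1)] x(3) by (simp add: u(3)[OF x(1)] v(3)[OF x(1)])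
  also have "(\<Sum>i<n. eigenvalues B ! i * (v i \<bullet> x)\<^sup>2)
      \<le> (\<Sum>i<n. eigenvalues B ! (k + ?r) * (v i \<bullet> x)\<^sup>2)"
  proof (rule sum_mono)
    fix i assume "i \<in> {..<n}"
    then show "eigenvalues B ! i * (v i \<bullet> x)\<^sup>2 \<le> eigenvalues B ! (k + ?r) * (v i \<bullet> x)\<^sup>2"
      using vx[of i] sorted_nth_mono[OF sorted_eigenvalues, of i "k + ?r" B] len k
      by (cases "k + ?r < i") (auto intro: mult_right_mono)
  qed
  also have "\<dots> = eigenvalues B ! (k + ?r) * (x \<bullet> x)"
    by (simp add: v(2)[OF x(1)] sum_distrib_left)
  finally have "eigenvalues A ! k * (x \<bullet> x) \<le> (eigenvalues B ! (k + ?r) + c) * (x \<bullet> x)"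
    by (simp add: algebra_simps)
  then show ?thesis using scalar_prod_self_pos[OF x(1,2)] by simp
qed

section \<open>Cauchy-Schwarz and the quadratic form of a rank-one matrix\<close>

lemma cauchy_schwarz_scalar_prod:
  fixes v x :: "real vec"
  assumes v: "v \<in> carrier_vec n" and x: "x \<in> carrier_vec n"
  shows "(v \<bullet> x)\<^sup>2 \<le> (v \<bullet> v) * (x \<bullet> x)"
proof (cases "v = 0\<^sub>v n")
  case True
  then show ?thesis using x by simp
next
  case False
  let ?t = "(v \<bullet> x) / (v \<bullet> v)"
  \<comment> \<open>The component of \<open>x\<close> orthogonal to \<open>v\<close>; its squared
    length being nonnegative is the claim divided by \<open>v \<bullet> v\<close>.\<close>
  let ?y = "x - ?t \<cdot>\<^sub>v v"
  have "0 \<le> ?y \<bullet> ?y" by (simp add: scalar_prod_def sum_nonneg)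
  also have "?y \<bullet> ?y = x \<bullet> x - ?t * (v \<bullet> x) - ?t * (v \<bullet> x - ?t * (v \<bullet> v))"
    using v x
    by (simp add: minus_scalar_prod_distrib[of _ n] scalar_prod_minus_distrib[of _ n]
        comm_scalar_prod[of x n v])
  finally show ?thesis
    using scalar_prod_self_pos[OF v False] by (simp add: field_simps power2_eq_square)
qed

lemma outer_square_carrier:
  assumes "v \<in> carrier_vec n"
  shows "outer_square v \<in> carrier_mat n n"
  unfolding outer_square_def using assms by (intro mult_carrier_mat[of _ n 1]) auto

lemma quadratic_form_outer_square:
  assumes v: "v \<in> carrier_vec n" and x: "x \<in> carrier_vec n"
  shows "x \<bullet> (outer_square v *\<^sub>v x) = (v \<bullet> x)\<^sup>2"
proof -
  have M: "outer_square v \<in> carrier_mat n n"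
    by (rule outer_square_carrier[OF v])
  have "outer_square v *\<^sub>v x = (v \<bullet> x) \<cdot>\<^sub>v v"
  proof (rule eq_vecI)
    fix i assume "i < dim_vec ((v \<bullet> x) \<cdot>\<^sub>v v)"
    then have i: "i < n" using v by simp
    have "(outer_square v *\<^sub>v x) $ i = (\<Sum>j\<in>{0..<n}. outer_square v $$ (i, j) * x $ j)"
      using i M x by (simp add: scalar_prod_def)
    also have "\<dots> = (\<Sum>j\<in>{0..<n}. v $ i * (v $ j * x $ j))"
      using i v by (intro sum.cong) (auto simp: index_outer_square)
    also have "\<dots> = v $ i * (v \<bullet> x)"
      using x by (simp add: scalar_prod_def sum_distrib_left)
    finally show "(outer_square v *\<^sub>v x) $ i = ((v \<bullet> x) \<cdot>\<^sub>v v) $ i" using i v by simp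
  qed (use M v in auto)
  then show ?thesis using v x by (simp add: power2_eq_square comm_scalar_prod[of x n v])
qed

section \<open>Sums over index pairs and the Lagrange identity\<close>

lemma finite_nat_pairs [simp]:
  "finite {(i, j). 1 \<le> i \<and> i < j \<and> j \<le> (m :: nat)}"
  "finite {(i, j). 1 \<le> i \<and> i \<le> j \<and> j \<le> (m :: nat)}"
  by (rule finite_subset[of _ "{1..m} \<times> {1..m}"]; force)+

text \<open>Serves both as the induction step for the Lagrange identity and to separate the edges at
  the last vertex from the rest of a Laplacian.\<close>

lemma sum_strict_pairs_Suc:
  fixes f :: "nat \<Rightarrow> nat \<Rightarrow> 'a :: comm_monoid_add"
  shows "(\<Sum>(i, j)\<in>{(i, j). 1 \<le> i \<and> i < j \<and> j \<le> Suc m}. f i j) =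
    (\<Sum>(i, j)\<in>{(i, j). 1 \<le> i \<and> i < j \<and> j \<le> m}. f i j) + (\<Sum>i = 1..m. f i (Suc m))"
proof -
  have "{(i, j). 1 \<le> i \<and> i < j \<and> j \<le> Suc m} =
      {(i, j). 1 \<le> i \<and> i < j \<and> j \<le> m} \<union> (\<lambda>i. (i, Suc m)) ` {1..m}"
    by auto
  moreover have "{(i, j). 1 \<le> i \<and> i < j \<and> j \<le> m} \<inter> (\<lambda>i. (i, Suc m)) ` {1..m} = {}"
    by auto
  ultimately show ?thesis
    by (simp add: sum.union_disjoint sum.reindex inj_on_def del: One_nat_def)
qed

lemma sum_pairs_Suc:
  fixes f :: "nat \<Rightarrow> nat \<Rightarrow> 'a :: comm_monoid_add"
  shows "(\<Sum>(i, j)\<in>{(i, j). 1 \<le> i \<and> i \<le> j \<and> j \<le> Suc m}. f i j) =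
    (\<Sum>(i, j)\<in>{(i, j). 1 \<le> i \<and> i \<le> j \<and> j \<le> m}. f i j) + (\<Sum>i = 1..Suc m. f i (Suc m))"
proof -
  have "{(i, j). 1 \<le> i \<and> i \<le> j \<and> j \<le> Suc m} =
      {(i, j). 1 \<le> i \<and> i \<le> j \<and> j \<le> m} \<union> (\<lambda>i. (i, Suc m)) ` {1..Suc m}"
    by auto
  moreover have "{(i, j). 1 \<le> i \<and> i \<le> j \<and> j \<le> m} \<inter> (\<lambda>i. (i, Suc m)) ` {1..Suc m} = {}"
    by auto
  ultimately show ?thesis
    by (simp add: sum.union_disjoint sum.reindex inj_on_def del: One_nat_def sum.cl_ivl_Suc)
qed

text \<open>Two families \<open>p\<close> and \<open>q\<close> appear because a matrix entry pairs a
  row coordinate with a column coordinate. In the induction, the new pairs \<open>(i, Suc m)\<close>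
  expand into the cross terms between the old sums and the new summand.\<close>

lemma lagrange_identity:
  fixes a p q :: "nat \<Rightarrow> real"
  shows "(\<Sum>i = 1..m. a i) * (\<Sum>i = 1..m. a i * (p i * q i)) =
    (\<Sum>(i, j)\<in>{(i, j). 1 \<le> i \<and> i < j \<and> j \<le> m}. a i * a j * ((p i - p j) * (q i - q j))) +
    (\<Sum>i = 1..m. a i * p i) * (\<Sum>i = 1..m. a i * q i)"
proof (induction m)
  case 0
  then show ?case by (auto intro!: sum.neutral)
next
  case (Suc m)
  let ?b = "a (Suc m)" and ?P = "p (Suc m)" and ?Q = "q (Suc m)"
  have "(\<Sum>i = 1..m. a i * ?b * ((p i - ?P) * (q i - ?Q))) =
      (\<Sum>i = 1..m. ?b * (a i * (p i * q i)) - ?b * ?Q * (a i * p i) - ?b * ?P * (a i * q i)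
        + ?b * ?P * ?Q * a i)"
    by (intro sum.cong) (auto simp: algebra_simps)
  also have "\<dots> = ?b * (\<Sum>i = 1..m. a i * (p i * q i)) - ?b * ?Q * (\<Sum>i = 1..m. a i * p i)
      - ?b * ?P * (\<Sum>i = 1..m. a i * q i) + ?b * ?P * ?Q * (\<Sum>i = 1..m. a i)"
    by (simp only: sum.distrib sum_subtractf sum_distrib_left)
  finally show ?case using Suc.IH
    unfolding sum_strict_pairs_Suc by (simp add: algebra_simps)
qed

text \<open>Doubling counts each off-diagonal product in both orders; with one copy of the diagonal
  this is the square of the sum, and the second copy is the sum of squares.\<close>

lemma sum_pairs_product:
  fixes a :: "nat \<Rightarrow> real"
  shows "2 * (\<Sum>(i, j)\<in>{(i, j). 1 \<le> i \<and> i \<le> j \<and> j \<le> m}. a i * a j) =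
    (\<Sum>i = 1..m. (a i)\<^sup>2) + (\<Sum>i = 1..m. a i)\<^sup>2"
proof (induction m)
  case 0
  then show ?case by (auto intro!: sum.neutral)
next
  case (Suc m)
  then show ?case unfolding sum_pairs_Suc
    by (simp add: algebra_simps power2_eq_square sum_distrib_left)
qed

section \<open>The star vector at vertex \<open>n\<close> and the rank-one reduction\<close>

lemma index_star_vec:
  assumes "r < n"
  shows "finsum_vec TYPE(real) n (\<lambda>i. a i \<cdot>\<^sub>v edge_vec n i n) {1..n - 1} $ r =
    (\<Sum>i = 1..n - 1. a i * (edge_vec n i n $ r))"
  using assms by (subst index_finsum_vec) (auto simp: edge_vec_def)

text \<open>The coordinates of \<open>v\<close> are the weights \<open>a 1, ..., a m\<close>,
  shifted down by one index, followed by minus their sum. Its squared length is the numerator of the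
  gap bound.\<close>

lemma star_vec_scalar_prod_self:
  fixes a :: "nat \<Rightarrow> real" and m :: nat
  defines "v \<equiv> finsum_vec TYPE(real) (Suc m) (\<lambda>i. a i \<cdot>\<^sub>v edge_vec (Suc m) i (Suc m)) {1..m}"
  shows "v \<bullet> v = 2 * (\<Sum>(i, j)\<in>{(i, j). 1 \<le> i \<and> i \<le> j \<and> j \<le> m}. a i * a j)"
proof -
  have v: "v \<in> carrier_vec (Suc m)"
    unfolding v_def by (rule finsum_vec_closed) (auto simp: edge_vec_def)
  have vi: "v $ r = a (Suc r)" if "r < m" for r
  proof -
    have "v $ r = (\<Sum>i = 1..m. a i * (edge_vec (Suc m) i (Suc m) $ r))"
      using index_star_vec[of r "Suc m" a] that by (simp add: v_def)
    also have "\<dots> = (\<Sum>i = 1..m. if i = Suc r then a i else 0)"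
      using that by (intro sum.cong) (auto simp: edge_vec_def unit_vec_def)
    finally show ?thesis using that by simp
  qed
  have vm: "v $ m = - (\<Sum>i = 1..m. a i)"
  proof -
    have "v $ m = (\<Sum>i = 1..m. a i * (edge_vec (Suc m) i (Suc m) $ m))"
      using index_star_vec[of m "Suc m" a] by (simp add: v_def)
    also have "\<dots> = (\<Sum>i = 1..m. - a i)"
      by (intro sum.cong) (auto simp: edge_vec_def unit_vec_def)
    finally show ?thesis by (simp add: sum_negf)
  qed
  have "v \<bullet> v = (\<Sum>r<m. (a (Suc r))\<^sup>2) + (\<Sum>i = 1..m. a i)\<^sup>2"
    using v by (simp add: scalar_prod_def atLeast0LessThan vi vm power2_eq_square)
  also have "(\<Sum>r<m. (a (Suc r))\<^sup>2) = (\<Sum>i = 1..m. (a i)\<^sup>2)"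
    by (rule sum.reindex_bij_witness[of _ "\<lambda>i. i - 1" Suc]) auto
  finally show ?thesis unfolding sum_pairs_product .
qed

lemma RW_laplacian_reduction:
  fixes \<alpha> :: "nat \<Rightarrow> nat \<Rightarrow> real"
  assumes S: "(\<Sum>i = 1..n - 1. \<alpha> i n) \<noteq> 0" and n: "0 < n"
  shows "RW_laplacian n \<alpha> = RW_laplacian n (reduced_weights n \<alpha>) +
      (1 / (\<Sum>i = 1..n - 1. \<alpha> i n)) \<cdot>\<^sub>m
        outer_square (finsum_vec TYPE(real) n (\<lambda>i. \<alpha> i n \<cdot>\<^sub>v edge_vec n i n) {1..n - 1})"
    (is "?L = ?L' + (1 / ?S) \<cdot>\<^sub>m outer_square ?v")
proof -
  obtain m where m: "n = Suc m" using n by (cases n) auto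
  have v: "?v \<in> carrier_vec n"
    by (rule finsum_vec_closed) (auto simp: edge_vec_def)
  have O: "outer_square ?v \<in> carrier_mat n n"
    by (rule outer_square_carrier[OF v])
  show ?thesis
  proof (rule eq_matI)
    fix r c assume "r < dim_row (?L' + (1 / ?S) \<cdot>\<^sub>m outer_square ?v)"
      "c < dim_col (?L' + (1 / ?S) \<cdot>\<^sub>m outer_square ?v)"
    then have rc: "r < n" "c < n" using O by auto
    let ?p = "\<lambda>i. edge_vec n i n $ r" and ?q = "\<lambda>i. edge_vec n i n $ c"
    let ?d = "\<lambda>i j. edge_vec n i j $ r * edge_vec n i j $ c"
    let ?T = "{(i, j). 1 \<le> i \<and> i < j \<and> j \<le> m}"
    \<comment> \<open>Every edge vector is a difference of two star edges:
      \<open>w_ij = w_in - w_jn\<close>.\<close>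
    have d: "?d i j = (?p i - ?p j) * (?q i - ?q j)" for i j
      using rc by (simp add: edge_vec_def)
    have weight: "reduced_weights n \<alpha> i j * ?d i j = \<alpha> i j * ?d i j
        + \<alpha> i n * \<alpha> j n * ((?p i - ?p j) * (?q i - ?q j)) / ?S" if "i < j" "j \<le> m" for i j
    proof -
      have "reduced_weights n \<alpha> i j = \<alpha> i j + \<alpha> i n * \<alpha> j n / ?S"
        using that m by (simp add: reduced_weights_def)
      then show ?thesis unfolding d[symmetric] by (simp add: distrib_right)
    qed
    have L: "?L $$ (r, c) = (\<Sum>(i, j)\<in>?T. \<alpha> i j * ?d i j) + (\<Sum>i = 1..m. \<alpha> i n * (?p i * ?q i))"
      unfolding index_RW_laplacian_sum[OF rc] unfolding m sum_strict_pairs_Suc by simp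
    \<comment> \<open>Edges at vertex \<open>n\<close> have reduced weight 0, so only the pairs
      below \<open>n\<close> survive.\<close>
    have "?L' $$ (r, c) = (\<Sum>(i, j)\<in>?T. reduced_weights n \<alpha> i j * ?d i j)"
      unfolding index_RW_laplacian_sum[OF rc] unfolding m sum_strict_pairs_Suc
      by (simp add: reduced_weights_def[of _ _ _ "Suc m"])
    also have "\<dots> = (\<Sum>(i, j)\<in>?T. \<alpha> i j * ?d i j
        + \<alpha> i n * \<alpha> j n * ((?p i - ?p j) * (?q i - ?q j)) / ?S)"
      by (rule sum.cong[OF refl]) (auto simp only: weight mem_Collect_eq prod.case)
    also have "\<dots> = (\<Sum>(i, j)\<in>?T. \<alpha> i j * ?d i j)
        + (\<Sum>(i, j)\<in>?T. \<alpha> i n * \<alpha> j n * ((?p i - ?p j) * (?q i - ?q j))) / ?S"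
      by (simp add: case_prod_beta sum.distrib sum_divide_distrib)
    finally have L': "?L' $$ (r, c) = \<dots>" .
    have O': "outer_square ?v $$ (r, c) = (\<Sum>i = 1..m. \<alpha> i n * ?p i) * (\<Sum>i = 1..m. \<alpha> i n * ?q i)"
      using index_star_vec[OF rc(1), of "\<lambda>i. \<alpha> i n"] index_star_vec[OF rc(2), of "\<lambda>i. \<alpha> i n"] rc v
      by (simp add: index_outer_square m)
    \<comment> \<open>Divided by \<open>?S\<close>, this says that the star edges of
      \<open>?L\<close> equal the weights added in \<open>?L'\<close> plus the rank-one
      term.\<close>
    have "?S * (\<Sum>i = 1..m. \<alpha> i n * (?p i * ?q i)) =
      (\<Sum>(i, j)\<in>?T. \<alpha> i n * \<alpha> j n * ((?p i - ?p j) * (?q i - ?q j))) + outer_square ?v $$ (r, c)"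
      unfolding O' using lagrange_identity[of "\<lambda>i. \<alpha> i n" m ?p ?q] by (simp add: m)
    then have "(\<Sum>i = 1..m. \<alpha> i n * (?p i * ?q i)) =
      (\<Sum>(i, j)\<in>?T. \<alpha> i n * \<alpha> j n * ((?p i - ?p j) * (?q i - ?q j))) / ?S
        + outer_square ?v $$ (r, c) / ?S"
      using S by (simp add: field_simps)
    then have "?L $$ (r, c) = ?L' $$ (r, c) + outer_square ?v $$ (r, c) / ?S"
      unfolding L L' by simp
    then show "?L $$ (r, c) = (?L' + (1 / ?S) \<cdot>\<^sub>m outer_square ?v) $$ (r, c)"
      using rc O RW_laplacian_carrier[of n "reduced_weights n \<alpha>"] by simp
  qed (use O RW_laplacian_carrier in auto)
qed

lemma quadratic_form_RW_laplacian_reduction: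
  assumes "(\<Sum>i = 1..n - 1. \<alpha> i n) \<noteq> 0" "0 < n" and x: "x \<in> carrier_vec n"
  defines "v \<equiv> finsum_vec TYPE(real) n (\<lambda>i. \<alpha> i n \<cdot>\<^sub>v edge_vec n i n) {1..n - 1}"
  shows "x \<bullet> (RW_laplacian n \<alpha> *\<^sub>v x) =
    x \<bullet> (RW_laplacian n (reduced_weights n \<alpha>) *\<^sub>v x) + (v \<bullet> x)\<^sup>2 / (\<Sum>i = 1..n - 1. \<alpha> i n)"
proof -
  let ?S = "\<Sum>i = 1..n - 1. \<alpha> i n" and ?L' = "RW_laplacian n (reduced_weights n \<alpha>)"
  have v: "v \<in> carrier_vec n"
    unfolding v_def by (rule finsum_vec_closed) (auto simp: edge_vec_def)
  have O: "outer_square v \<in> carrier_mat n n"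
    by (rule outer_square_carrier[OF v])
  have smult: "((1 / ?S) \<cdot>\<^sub>m outer_square v) *\<^sub>v x = (1 / ?S) \<cdot>\<^sub>v (outer_square v *\<^sub>v x)"
    using O x by (intro eq_vecI) auto
  have "x \<bullet> (RW_laplacian n \<alpha> *\<^sub>v x) =
      x \<bullet> (?L' *\<^sub>v x + (1 / ?S) \<cdot>\<^sub>v (outer_square v *\<^sub>v x))"
    unfolding RW_laplacian_reduction[of \<alpha>, OF assms(1,2)] v_def[symmetric] smult[symmetric]
    using O x RW_laplacian_carrier by (subst add_mult_distrib_mat_vec[of _ n n]) auto
  also have "\<dots> = x \<bullet> (?L' *\<^sub>v x) + (1 / ?S) * (x \<bullet> (outer_square v *\<^sub>v x))"
    using O x RW_laplacian_carrier[of n "reduced_weights n \<alpha>"]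
    by (subst scalar_prod_add_distrib[of _ n]) (auto intro: mult_mat_vec_carrier)
  finally show ?thesis using quadratic_form_outer_square[OF v x] by simp
qed

section \<open>Reduction identity, interlacing and the gap bound\<close>

theorem proposition1:
  fixes n :: nat and \<alpha> :: "nat \<Rightarrow> nat \<Rightarrow> real"
  assumes "n \<ge> 2"
    and "edge_weights n \<alpha>"
    and "(\<Sum>i = 1..n - 1. \<alpha> i n) > 0"
  shows "(RW_laplacian n \<alpha> = RW_laplacian n (reduced_weights n \<alpha>) +
      (1 / (\<Sum>i = 1..n - 1. \<alpha> i n)) \<cdot>\<^sub>m
        outer_square (finsum_vec TYPE(real) n (\<lambda>i. \<alpha> i n \<cdot>\<^sub>v edge_vec n i n) {1..n - 1})) \<and>
    (\<forall>k\<in>{1..n}.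
      RW_eigenvalue k n (reduced_weights n \<alpha>) \<le> RW_eigenvalue k n \<alpha>) \<and>
    (\<forall>k\<in>{1..n - 1}.
      RW_eigenvalue k n \<alpha> \<le> RW_eigenvalue (k + 1) n (reduced_weights n \<alpha>)) \<and>
    (\<forall>k\<in>{1..n}.
      RW_eigenvalue k n \<alpha> - RW_eigenvalue k n (reduced_weights n \<alpha>) \<le>
        2 * (\<Sum>(i, j)\<in>{(i, j). 1 \<le> i \<and> i \<le> j \<and> j \<le> n - 1}. \<alpha> i n * \<alpha> j n) /
          (\<Sum>i = 1..n - 1. \<alpha> i n))"
proof -
  let ?L = "RW_laplacian n \<alpha>" and ?L' = "RW_laplacian n (reduced_weights n \<alpha>)"
  let ?S = "\<Sum>i = 1..n - 1. \<alpha> i n"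
  let ?v = "finsum_vec TYPE(real) n (\<lambda>i. \<alpha> i n \<cdot>\<^sub>v edge_vec n i n) {1..n - 1}"
  let ?c = "2 * (\<Sum>(i, j)\<in>{(i, j). 1 \<le> i \<and> i \<le> j \<and> j \<le> n - 1}. \<alpha> i n * \<alpha> j n) / ?S"
  have S: "?S \<noteq> 0" "0 < ?S" and n: "0 < n" using assms by auto
  have v: "?v \<in> carrier_vec n"
    by (rule finsum_vec_closed) (auto simp: edge_vec_def)
  have vv: "(?v \<bullet> ?v) / ?S = ?c"
    using star_vec_scalar_prod_self[of "n - 1" "\<lambda>i. \<alpha> i n"] n by simp
  note quad = quadratic_form_RW_laplacian_reduction[of \<alpha>, OF S(1) n]
  note compare = eigenvalue_comparison[OF RW_laplacian_carrier RW_laplacian_symmetric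
      RW_laplacian_carrier RW_laplacian_symmetric]
  have mono: "RW_eigenvalue k n (reduced_weights n \<alpha>) \<le> RW_eigenvalue k n \<alpha>" if "k \<in> {1..n}" for k
  proof -
    \<comment> \<open>Dropping the nonnegative square from \<open>quad\<close> compares the forms on
      all vectors. List positions are \<open>k - 1\<close> because eigenvalues are numbered from
      1.\<close>
    have "eigenvalues ?L' ! (k - 1) \<le> eigenvalues ?L ! (k - 1 + length ([] :: real vec list)) + 0"
    proof (rule compare)
      fix x :: "real vec" assume "x \<in> carrier_vec n"
      then show "x \<bullet> (?L' *\<^sub>v x) \<le> x \<bullet> (?L *\<^sub>v x) + 0 * (x \<bullet> x)"
        using quad S by simp
    qed (use that in auto)
    then show ?thesis by (simp add: RW_eigenvalue_def)
  qed
  have interlace: "RW_eigenvalue k n \<alpha> \<le> RW_eigenvalue (k + 1) n (reduced_weights n \<alpha>)"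
    if "k \<in> {1..n - 1}" for k
  proof -
    \<comment> \<open>On the hyperplane orthogonal to \<open>?v\<close> the two forms agree; this
      one constraint shifts the index by one.\<close>
    have "eigenvalues ?L ! (k - 1) \<le> eigenvalues ?L' ! (k - 1 + length [?v]) + 0"
    proof (rule compare)
      fix x :: "real vec" assume "x \<in> carrier_vec n" "\<And>w. w \<in> set [?v] \<Longrightarrow> w \<bullet> x = 0"
      then show "x \<bullet> (?L *\<^sub>v x) \<le> x \<bullet> (?L' *\<^sub>v x) + 0 * (x \<bullet> x)"
        using quad by simp
    qed (use that v in auto)
    then show ?thesis using that by (simp add: RW_eigenvalue_def)
  qed
  have gap: "RW_eigenvalue k n \<alpha> - RW_eigenvalue k n (reduced_weights n \<alpha>) \<le> ?c"
    if "k \<in> {1..n}" for k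
  proof -
    have "eigenvalues ?L ! (k - 1) \<le> eigenvalues ?L' ! (k - 1 + length ([] :: real vec list)) + ?c"
    proof (rule compare)
      fix x :: "real vec" assume x: "x \<in> carrier_vec n"
      \<comment> \<open>Cauchy-Schwarz bounds the rank-one term by a multiple of
        \<open>x \<bullet> x\<close>, and \<open>vv\<close> identifies the factor as
        \<open>?c\<close>.\<close>
      have "(?v \<bullet> x)\<^sup>2 / ?S \<le> (?v \<bullet> ?v) * (x \<bullet> x) / ?S"
        using cauchy_schwarz_scalar_prod[OF v x] S by (intro divide_right_mono) auto
      also have "\<dots> = ?c * (x \<bullet> x)" unfolding vv[symmetric] by simp
      finally show "x \<bullet> (?L *\<^sub>v x) \<le> x \<bullet> (?L' *\<^sub>v x) + ?c * (x \<bullet> x)"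
        using quad[OF x] by simp
    qed (use that in auto)
    then show ?thesis by (simp add: RW_eigenvalue_def)
  qed
  show ?thesis using RW_laplacian_reduction[of \<alpha>, OF S(1) n] mono interlace gap by blast
qed

end
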